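(* Let $n\ge 2$ be an integer, let $\alpha\in(0,1/(n-1))$, and let $f(x)=\frac12x^TAx$ on $\mathbb{R}^n$ with Hessian matrix $A=(1+\alpha)I-\alpha\mathbf{1}\mathbf{1}^T$. Let $\mu=1-\alpha(n-1)$ and let $x^*=0$ be the minimizer of $f$. Then, for any initial point $x^0\in\mathbb{R}^n$ and every integer $\ell\ge 0$, the RPCD iterates $x_{\mathrm{RPCD}}^{\ell n}$ (after $\ell$ epochs) started from $x^0$ satisfy $$\mathbb{E}\,\|x_{\mathrm{RPCD}}^{\ell n}-x^*\|^2\le\left(1-\frac{2\mu}{n}\left(\frac{(1+\alpha)^n-1}{\alpha}\right)+\frac{\mu^2}{n}\left(\frac{(1+\alpha)^{2n}-1}{\alpha(\alpha+2)}\right)\right)^{\ell}\|x^0-x^*\|^2$$ and $$\mathbb{E}f(x_{\mathrm{RPCD}}^{\ell n})-f(x^* )\le\left(1-\frac{\mu}{n}\left(\frac{(1+\alpha)^{2n}-1}{\alpha(\alpha+2)}\right)\right)^{\ell}\left(f(x^0)-f(x^* )\right).$$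
   Context: $\mathbf{1}\in\mathbb{R}^n$ is the all-ones vector, $e_i$ is the $i$-th standard basis vector, and $\|\cdot\|$ is the Euclidean norm. RPCD (random-permutations cyclic coordinate descent with exact line search): $x_{\mathrm{RPCD}}^0=x^0$ is deterministic. At the beginning of each epoch $\ell=0,1,2,\dots$ a permutation $\pi_\ell$ of $\{1,\dots,n\}$ is drawn uniformly at random, independently of the permutations of all other epochs. For $j=0,\dots,n-1$, with $k=\ell n+j$ and $i_k$ the $(j+1)$-th element of $\pi_\ell$, the update is $$x_{\mathrm{RPCD}}^{k+1}=x_{\mathrm{RPCD}}^{k}-\frac{1}{A_{i_ki_k}}(Ax_{\mathrm{RPCD}}^{k})_{i_k}e_{i_k}$$ (here $A_{ii}=1$ for all $i$). The number $\mu$ is the smallest eigenvalue of $A$. $\mathbb{E}$ is expectation over all random permutations. *)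

theory Defs
  imports "HOL-Probability.Probability" "HOL-Combinatorics.Multiset_Permutations"
begin

definition quad :: "real^'n^'n \<Rightarrow> real^'n \<Rightarrow> real" where
  "quad A x = 1/2 * (x \<bullet> (A *v x))"

text \<open>\<open>(1 + \<alpha>) I - \<alpha> 1 1\<^sup>T\<close>; here \<open>1 :: real^'n\<close> is the all-ones vector.\<close>

definition hess :: "real \<Rightarrow> real^'n^'n" where
  "hess \<alpha> = (1 + \<alpha>) *\<^sub>R mat 1 -
     \<alpha> *\<^sub>R ((columnvector 1 :: real^1^'n) ** (rowvector 1 :: real^'n^1))"

definition cd_step :: "real^'n^'n \<Rightarrow> 'n \<Rightarrow> real^'n \<Rightarrow> real^'n" where
  "cd_step A i x = x - ((1 / A $ i $ i) * (A *v x) $ i) *\<^sub>R axis i 1"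

text \<open>
  A permutation of the coordinates is represented by the list of coordinates in the order in
  which they are visited, so \<open>\<pi> l ! j\<close> (with \<open>j\<close> counted from \<open>0\<close>) is the coordinate used in
  step \<open>l * n + j\<close>, where \<open>n = CARD('n)\<close>.
\<close>

primrec rpcd :: "real^'n^'n \<Rightarrow> (nat \<Rightarrow> 'n list) \<Rightarrow> real^'n \<Rightarrow> nat \<Rightarrow> real^'n" where
  "rpcd A \<pi> x0 0 = x0"
| "rpcd A \<pi> x0 (Suc k) =
     cd_step A (\<pi> (k div CARD('n)) ! (k mod CARD('n))) (rpcd A \<pi> x0 k)"

text \<open>
  One independent, uniformly distributed ordering of all coordinates per epoch, on an arbitrary
  probability space \<open>M\<close>. Measurability of each \<open>\<pi> l\<close> is part of \<^const>\<open>prob_space.indep_vars\<close>.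
\<close>

definition random_orders :: "'a measure \<Rightarrow> (nat \<Rightarrow> 'a \<Rightarrow> 'n::finite list) \<Rightarrow> bool" where
  "random_orders M \<pi> \<longleftrightarrow>
     prob_space M \<and>
     prob_space.indep_vars M (\<lambda>_. count_space UNIV) \<pi> UNIV \<and>
     (\<forall>l. distr M (count_space UNIV) (\<pi> l) =
           measure_pmf (pmf_of_set (permutations_of_set UNIV)))"

lemma hess_nth: "hess \<alpha> $ i $ j = (if i = j then 1 else - \<alpha>)"
  by (simp add: hess_def mat_def columnvector_def rowvector_def matrix_matrix_mult_def)

lemma hess_mult_nth:
  fixes x :: "real^'n"
  shows "(hess \<alpha> *v x) $ i = (1 + \<alpha>) * x $ i - \<alpha> * (\<Sum>j\<in>UNIV. x $ j)"
proof -
  have "(hess \<alpha> *v x) $ i = (\<Sum>j\<in>UNIV. (if i = j then (1 + \<alpha>) * x $ j else 0) - \<alpha> * x $ j)"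
    unfolding matrix_vector_mult_def
    by (auto simp: hess_nth algebra_simps intro!: sum.cong)
  then show ?thesis
    by (simp add: sum_subtractf sum_distrib_left)
qed

lemma quad_hess:
  fixes x :: "real^'n"
  shows "x \<bullet> (hess \<alpha> *v x) = (1 + \<alpha>) * (norm x)\<^sup>2 - \<alpha> * (\<Sum>j\<in>UNIV. x $ j)\<^sup>2"
proof -
  have "x \<bullet> (hess \<alpha> *v x) =
      (\<Sum>i\<in>UNIV. (1 + \<alpha>) * (x $ i * x $ i) - \<alpha> * (\<Sum>j\<in>UNIV. x $ j) * x $ i)"
    by (simp add: inner_vec_def hess_mult_nth algebra_simps)
  also have "\<dots> = (1 + \<alpha>) * (x \<bullet> x) - \<alpha> * (\<Sum>j\<in>UNIV. x $ j) * (\<Sum>j\<in>UNIV. x $ j)"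
    by (simp add: sum_subtractf sum_distrib_left inner_vec_def)
  finally show ?thesis
    by (simp only: power2_norm_eq_inner) (simp add: power2_eq_square)
qed

lemma hess_lower:
  fixes x :: "real^'n"
  assumes "\<alpha> \<ge> 0"
  shows "x \<bullet> (hess \<alpha> *v x) \<ge> (1 - \<alpha> * (real CARD('n) - 1)) * (norm x)\<^sup>2"
proof -
  have "(x \<bullet> 1)\<^sup>2 \<le> (x \<bullet> x) * ((1 :: real^'n) \<bullet> 1)"
    by (rule Cauchy_Schwarz_ineq)
  then have "(\<Sum>j\<in>UNIV. x $ j)\<^sup>2 \<le> real CARD('n) * (norm x)\<^sup>2"
    by (simp add: inner_vec_def power2_norm_eq_inner mult.commute)
  then have "\<alpha> * (\<Sum>j\<in>UNIV. x $ j)\<^sup>2 \<le> \<alpha> * (real CARD('n) * (norm x)\<^sup>2)"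
    using assms by (rule mult_left_mono)
  then show ?thesis
    by (simp add: quad_hess algebra_simps)
qed

text \<open>The number \<open>1 - \<alpha> (n - 1)\<close> is the smallest eigenvalue of \<open>hess \<alpha>\<close>.\<close>

lemma hess_smallest_eigenvalue:
  assumes "\<alpha> \<ge> 0"
  shows "is_arg_min id (\<lambda>c. \<exists>v::real^'n. v \<noteq> 0 \<and> hess \<alpha> *v v = c *\<^sub>R v)
           (1 - \<alpha> * (real CARD('n) - 1))"
  unfolding is_arg_min_linorder
proof (intro conjI allI impI)
  have "(1::real^'n) \<noteq> 0" by (simp add: vec_eq_iff)
  moreover have "hess \<alpha> *v 1 = (1 - \<alpha> * (real CARD('n) - 1)) *\<^sub>R (1::real^'n)"
    by (simp add: vec_eq_iff hess_mult_nth algebra_simps)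
  ultimately show "\<exists>v::real^'n. v \<noteq> 0 \<and>
      hess \<alpha> *v v = (1 - \<alpha> * (real CARD('n) - 1)) *\<^sub>R v" by blast
next
  fix c assume "\<exists>v::real^'n. v \<noteq> 0 \<and> hess \<alpha> *v v = c *\<^sub>R v"
  then obtain v :: "real^'n" where v: "v \<noteq> 0" "hess \<alpha> *v v = c *\<^sub>R v" by blast
  have "(1 - \<alpha> * (real CARD('n) - 1)) * (norm v)\<^sup>2 \<le> c * (norm v)\<^sup>2"
    using hess_lower[OF assms, of v] v by (simp add: power2_norm_eq_inner)
  with v show "id (1 - \<alpha> * (real CARD('n) - 1)) \<le> id c" by simp
qed

lemma quad_hess_minimizer:
  fixes x :: "real^'n"
  assumes "0 \<le> \<alpha>" "\<alpha> * (real CARD('n) - 1) < 1"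
  shows "is_arg_min (quad (hess \<alpha>)) (\<lambda>_. True) x \<longleftrightarrow> x = 0"
proof -
  have z: "quad (hess \<alpha>) (0::real^'n) = 0" by (simp add: quad_def)
  have pos: "quad (hess \<alpha>) y > 0" if "y \<noteq> 0" for y :: "real^'n"
  proof -
    have "0 < (1 - \<alpha> * (real CARD('n) - 1)) * (norm y)\<^sup>2"
      using assms that by simp
    also have "\<dots> \<le> y \<bullet> (hess \<alpha> *v y)"
      by (rule hess_lower) fact
    finally show ?thesis by (simp add: quad_def)
  qed
  show ?thesis
    unfolding is_arg_min_linorder using z pos by (metis less_le_not_le order.refl less_imp_le)
qed

end

theory Submission
  imports Defs
begin

text \<open>
  Write \<open>n\<close> for the dimension, \<open>b = 1 + \<alpha>\<close>, and \<open>1\<close> for the all-ones vector. A sweep in a given order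
  acts linearly on the starting point \<open>x\<close>. For \<open>x = 1\<close> the order does not affect the norm or the
  objective at the end, and the contraction factors in the theorem are exactly the ratios by which one
  sweep reduces the squared norm and the objective of \<open>1\<close>. The point is that, on average over the
  order, no vector contracts less than \<open>1\<close>.

  A step replaces \<open>x\<^sub>i\<close> by \<open>\<alpha>\<close> times the sum of the other coordinates. During a sweep everything is
  therefore governed by the sum of all coordinates, which obeys a linear recursion with an explicit
  solution (\<open>sweep_coordinate_sum\<close>), and the new coordinates as well as the derivatives met on the way
  are explicit linear forms in the coordinates of \<open>x\<close>, taken in the order of the sweep, with geometric
  weights.

  For the squared norm it suffices that the new coordinates are linear forms with nonnegative weights:
  by convexity the average square of such a form is at most the square of its value at a constant
  vector of the same norm (\<open>sum_orders_nonneg_weights_le\<close>).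

  The objective decreases in a sweep by half the sum of the squared derivatives. These have weights of
  both signs, so their averages are computed exactly (\<open>sum_orders_affine_square\<close>). As a form in \<open>x\<close>
  the average objective is invariant under permutations of the coordinates, like the objective itself, so
  both are combinations of the squared norms of the projections of \<open>x\<close> to the line through \<open>1\<close> and to its
  orthogonal complement, and only the contraction ratios on these two spaces have to be compared. The
  comparison is the inequality \<open>geometric_mean_inequality\<close> for the average of the powers \<open>b\<^sup>0, b\<^sup>2, b\<^sup>4, \<dots>\<close>.

  Finally, since the orders of different epochs are independent, a contraction of the average over one
  order iterates to a contraction of the expectation (\<open>expectation_rpcd_le\<close>). This uses that the
  factors are nonnegative, which for the objective comes from \<open>\<mu> > 0\<close>.
\<close>

section \<open>Second moments under a uniformly random ordering\<close>

text \<open>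
  Exchanging two positions is an involution on the set of all orderings. By this symmetry an
  average of products of two entries depends only on whether their positions coincide.
\<close>

lemma sum_orders_swap_positions:
  fixes G :: "'b list \<Rightarrow> real"
  assumes "i < card A" "k < card A"
  shows "(\<Sum>ys\<in>permutations_of_set A. G (permute_list (Transposition.transpose i k) ys))
       = (\<Sum>ys\<in>permutations_of_set A. G ys)"
proof -
  let ?t = "Transposition.transpose i k"
  have t: "?t permutes {..<length ys}" if "ys \<in> permutations_of_set A" for ys
    using assms that by (intro permutes_swap_id) (auto simp: length_finite_permutations_of_set)
  have inv: "permute_list ?t (permute_list ?t ys) = ys" if "ys \<in> permutations_of_set A" for ys
    using permute_list_compose[OF t[OF that], of ?t] by (simp add: o_def)
  have mem: "permute_list ?t ys \<in> permutations_of_set A" if "ys \<in> permutations_of_set A" for ys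
    using t[OF that] that
    by (auto simp: permutations_of_set_def)
  show ?thesis
    by (rule sum.reindex_bij_witness[where i = "permute_list ?t" and j = "permute_list ?t"])
      (auto simp: inv mem)
qed

lemma sum_orders_pair_transfer:
  fixes x :: "'b \<Rightarrow> real"
  assumes "i < card A" "k < card A" "k' < card A" "i \<noteq> k" "i \<noteq> k'"
  shows "(\<Sum>ys\<in>permutations_of_set A. x (ys ! i) * x (ys ! k))
       = (\<Sum>ys\<in>permutations_of_set A. x (ys ! i) * x (ys ! k'))"
proof -
  let ?t = "Transposition.transpose k k'"
  have "(\<Sum>ys\<in>permutations_of_set A. x (ys ! i) * x (ys ! k'))
      = (\<Sum>ys\<in>permutations_of_set A. x (permute_list ?t ys ! i) * x (permute_list ?t ys ! k'))"
    using sum_orders_swap_positions[OF assms(2,3), of "\<lambda>ys. x (ys ! i) * x (ys ! k')"] by simp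
  also have "\<dots> = (\<Sum>ys\<in>permutations_of_set A. x (ys ! i) * x (ys ! k))"
    using assms
    by (intro sum.cong refl)
      (auto simp: permute_list_nth permutes_swap_id length_finite_permutations_of_set
         Transposition.transpose_def)
  finally show ?thesis ..
qed

lemma sum_over_positions:
  fixes F :: "'b \<Rightarrow> real"
  assumes "ys \<in> permutations_of_set A"
  shows "(\<Sum>i<card A. F (ys ! i)) = (\<Sum>a\<in>A. F a)"
proof -
  have "ys ! i \<in> A" if "i < length ys" for i
    using assms that by (auto simp: permutations_of_set_def)
  have "(\<Sum>a\<in>A. F a) = sum_list (map F ys)"
    using assms by (simp add: permutations_of_set_def sum_list_distinct_conv_sum_set)
  also have "\<dots> = (\<Sum>i<length ys. F (ys ! i))"
    by (simp add: sum_list_sum_nth atLeast0LessThan)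
  finally show ?thesis
    using assms by (simp add: length_finite_permutations_of_set)
qed

lemma sum_orders_square_at:
  fixes x :: "'b \<Rightarrow> real"
  assumes A: "finite A" and i: "i < card A"
  shows "(\<Sum>ys\<in>permutations_of_set A. (x (ys ! i))\<^sup>2)
       = fact (card A) * (\<Sum>a\<in>A. (x a)\<^sup>2) / card A"
proof -
  let ?n = "card A" and ?T = "\<lambda>i. \<Sum>ys\<in>permutations_of_set A. (x (ys ! i))\<^sup>2"
  have eq: "?T k = ?T i" if "k < ?n" for k
  proof -
    let ?t = "Transposition.transpose i k"
    have "?T k = (\<Sum>ys\<in>permutations_of_set A. (x (permute_list ?t ys ! k))\<^sup>2)"
      using sum_orders_swap_positions[OF i that, of "\<lambda>ys. (x (ys ! k))\<^sup>2"] by simp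
    also have "\<dots> = ?T i"
      using i that
      by (intro sum.cong refl)
        (auto simp: permute_list_nth permutes_swap_id length_finite_permutations_of_set)
    finally show ?thesis .
  qed
  have "?n * ?T i = (\<Sum>k<?n. ?T k)"
    using eq by simp
  also have "\<dots> = (\<Sum>ys\<in>permutations_of_set A. \<Sum>k<?n. (x (ys ! k))\<^sup>2)"
    by (rule sum.swap)
  also have "\<dots> = (\<Sum>ys\<in>permutations_of_set A. \<Sum>a\<in>A. (x a)\<^sup>2)"
    by (intro sum.cong refl sum_over_positions[where F = "\<lambda>a. (x a)\<^sup>2"])
  also have "\<dots> = fact ?n * (\<Sum>a\<in>A. (x a)\<^sup>2)"
    using A by simp
  finally show ?thesis
    using i by (simp add: field_simps)
qed

text \<open>
  Convexity of the square gives \<open>(\<Sum>\<^sub>i u\<^sub>i z\<^sub>i)\<^sup>2 \<le> (\<Sum>\<^sub>i u\<^sub>i) (\<Sum>\<^sub>i u\<^sub>i z\<^sub>i\<^sup>2)\<close> for nonnegative weights, and every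
  position carries the same average square. Constant \<open>x\<close> gives equality.
\<close>

lemma sum_orders_nonneg_weights_le:
  fixes x :: "'b \<Rightarrow> real" and u :: "nat \<Rightarrow> real"
  assumes A: "finite A" and n: "card A = n" and u: "\<And>i. i < n \<Longrightarrow> 0 \<le> u i"
  shows "(\<Sum>ys\<in>permutations_of_set A. (\<Sum>i<n. u i * x (ys ! i))\<^sup>2)
       \<le> fact n * ((\<Sum>i<n. u i)\<^sup>2 / n * (\<Sum>a\<in>A. (x a)\<^sup>2))"
proof -
  let ?q = "\<Sum>a\<in>A. (x a)\<^sup>2"
  have "(\<Sum>ys\<in>permutations_of_set A. (\<Sum>i<n. u i * x (ys ! i))\<^sup>2)
      \<le> (\<Sum>ys\<in>permutations_of_set A. (\<Sum>i<n. u i) * (\<Sum>i<n. u i * (x (ys ! i))\<^sup>2))"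
  proof (rule sum_mono)
    fix ys
    have "(\<Sum>i<n. u i * x (ys ! i)) = (\<Sum>i<n. sqrt (u i) * (sqrt (u i) * x (ys ! i)))"
      using u by (intro sum.cong refl) (simp add: mult.assoc[symmetric])
    also have "\<dots>\<^sup>2 \<le> (\<Sum>i<n. (sqrt (u i))\<^sup>2) * (\<Sum>i<n. (sqrt (u i) * x (ys ! i))\<^sup>2)"
      by (rule Cauchy_Schwarz_ineq_sum)
    also have "\<dots> = (\<Sum>i<n. u i) * (\<Sum>i<n. u i * (x (ys ! i))\<^sup>2)"
      using u by (simp add: power_mult_distrib)
    finally show "(\<Sum>i<n. u i * x (ys ! i))\<^sup>2 \<le> (\<Sum>i<n. u i) * (\<Sum>i<n. u i * (x (ys ! i))\<^sup>2)" .
  qed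
  also have "\<dots> = (\<Sum>i<n. u i) * (\<Sum>i<n. u i * (\<Sum>ys\<in>permutations_of_set A. (x (ys ! i))\<^sup>2))"
    unfolding sum_distrib_left[symmetric] by (subst sum.swap) (simp only: sum_distrib_left)
  also have "\<dots> = (\<Sum>i<n. u i) * (\<Sum>i<n. u i * (fact n * ?q / n))"
    using sum_orders_square_at[OF A, of _ x] n by simp
  also have "\<dots> = fact n * ((\<Sum>i<n. u i)\<^sup>2 / n * ?q)"
    unfolding sum_distrib_right[symmetric] by (simp add: power2_eq_square)
  finally show ?thesis .
qed

text \<open>
  By symmetry all pairs of distinct positions give the same value. The sum over all pairs of
  positions is known, being \<open>(\<Sum>a. x a)\<^sup>2\<close> for every ordering, so subtracting the diagonal determines
  that common value.
\<close>

lemma sum_orders_product_at: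
  fixes x :: "'b \<Rightarrow> real"
  assumes A: "finite A" and ik: "i < card A" "k < card A" "i \<noteq> k"
  shows "(\<Sum>ys\<in>permutations_of_set A. x (ys ! i) * x (ys ! k))
       = fact (card A) * ((\<Sum>a\<in>A. x a)\<^sup>2 - (\<Sum>a\<in>A. (x a)\<^sup>2)) / (real (card A) * (real (card A) - 1))"
proof -
  let ?n = "card A"
  define T where "T i k = (\<Sum>ys\<in>permutations_of_set A. x (ys ! i) * x (ys ! k))" for i k
  have sym: "T i k = T k i" for i k
    by (simp add: T_def mult.commute)
  have move: "T i k = T i k'" if "i < ?n" "k < ?n" "k' < ?n" "i \<noteq> k" "i \<noteq> k'" for i k k'
    unfolding T_def by (rule sum_orders_pair_transfer) fact+
  have eq: "T i' k' = T i k" if "i' < ?n" "k' < ?n" "i' \<noteq> k'" for i' k'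
    using ik that by (metis sym move)
  have diag: "T i i = fact ?n * (\<Sum>a\<in>A. (x a)\<^sup>2) / ?n" if "i < ?n" for i
    using sum_orders_square_at[OF A that, of x] by (simp add: T_def power2_eq_square)
  have row: "(\<Sum>k'<?n. T i' k') = fact ?n * (\<Sum>a\<in>A. (x a)\<^sup>2) / ?n + (real ?n - 1) * T i k"
    if "i' < ?n" for i'
  proof -
    have "(\<Sum>k'<?n. T i' k') = T i' i' + (\<Sum>k'\<in>{..<?n} - {i'}. T i' k')"
      using that by (simp add: sum.remove)
    also have "(\<Sum>k'\<in>{..<?n} - {i'}. T i' k') = (\<Sum>k'\<in>{..<?n} - {i'}. T i k)"
      using that by (intro sum.cong refl eq) auto
    finally show ?thesis
      using that by (simp add: diag of_nat_diff)
  qed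
  have "fact ?n * (\<Sum>a\<in>A. x a)\<^sup>2
      = (\<Sum>ys\<in>permutations_of_set A. (\<Sum>i<?n. x (ys ! i)) * (\<Sum>k<?n. x (ys ! k)))"
    using A by (simp add: sum_over_positions power2_eq_square)
  also have "\<dots> = (\<Sum>ys\<in>permutations_of_set A. \<Sum>i<?n. \<Sum>k<?n. x (ys ! i) * x (ys ! k))"
    by (simp add: sum_product)
  also have "\<dots> = (\<Sum>i<?n. \<Sum>ys\<in>permutations_of_set A. \<Sum>k<?n. x (ys ! i) * x (ys ! k))"
    by (rule sum.swap)
  also have "\<dots> = (\<Sum>i<?n. \<Sum>k<?n. T i k)"
    unfolding T_def by (intro sum.cong refl sum.swap)
  also have "\<dots> = real ?n * (fact ?n * (\<Sum>a\<in>A. (x a)\<^sup>2) / ?n + (real ?n - 1) * T i k)"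
    by (simp add: row)
  also have "\<dots> = fact ?n * (\<Sum>a\<in>A. (x a)\<^sup>2) + real ?n * (real ?n - 1) * T i k"
    using ik by (simp add: field_simps)
  finally have *: "fact ?n * ((\<Sum>a\<in>A. x a)\<^sup>2 - (\<Sum>a\<in>A. (x a)\<^sup>2)) = real ?n * (real ?n - 1) * T i k"
    by (simp add: algebra_simps)
  have "real ?n \<noteq> 0" "real ?n - 1 \<noteq> 0"
    using ik by auto
  then show ?thesis
    unfolding T_def[symmetric] * by simp
qed

lemma sum_orders_linear_square:
  fixes x :: "'b \<Rightarrow> real" and w :: "nat \<Rightarrow> real"
  assumes A: "finite A" and n: "card A = n" "n \<ge> 2"
  defines "S \<equiv> \<Sum>a\<in>A. x a" and "q \<equiv> \<Sum>a\<in>A. (x a)\<^sup>2"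
  shows "(\<Sum>ys\<in>permutations_of_set A. (\<Sum>i<n. w i * x (ys ! i))\<^sup>2)
       = fact n * ((\<Sum>i<n. w i)\<^sup>2 * (S / n)\<^sup>2
           + (n * (\<Sum>i<n. (w i)\<^sup>2) - (\<Sum>i<n. w i)\<^sup>2) / (real n * (real n - 1)) * (q - S\<^sup>2 / n))"
proof -
  define d where "d = fact n * q / n"
  define e where "e = fact n * (S\<^sup>2 - q) / (real n * (real n - 1))"
  have T: "(\<Sum>ys\<in>permutations_of_set A. x (ys ! i) * x (ys ! k)) = e + (if i = k then d - e else 0)"
    if "i < n" "k < n" for i k
    using sum_orders_square_at[OF A, of i x] sum_orders_product_at[OF A, of i k x] that n
    by (auto simp: d_def e_def S_def q_def power2_eq_square)
  have "(\<Sum>ys\<in>permutations_of_set A. (\<Sum>i<n. w i * x (ys ! i))\<^sup>2)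
      = (\<Sum>ys\<in>permutations_of_set A. \<Sum>i<n. \<Sum>k<n. w i * w k * (x (ys ! i) * x (ys ! k)))"
    by (simp add: power2_eq_square sum_product mult_ac)
  also have "\<dots> = (\<Sum>i<n. \<Sum>k<n. w i * w k * (\<Sum>ys\<in>permutations_of_set A. x (ys ! i) * x (ys ! k)))"
    unfolding sum_distrib_left
    by (subst sum.swap) (intro sum.cong refl sum.swap)
  also have "\<dots> = (\<Sum>i<n. \<Sum>k<n. w i * w k * e + (if i = k then w i * w k * (d - e) else 0))"
    by (intro sum.cong refl) (auto simp: T algebra_simps)
  also have "\<dots> = e * (\<Sum>i<n. w i)\<^sup>2 + (d - e) * (\<Sum>i<n. (w i)\<^sup>2)"
  proof -
    have "(\<Sum>i<n. \<Sum>k<n. w i * w k * e) = e * (\<Sum>i<n. w i)\<^sup>2"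
      by (simp add: power2_eq_square sum_product sum_distrib_left mult_ac)
    moreover have "(\<Sum>i<n. \<Sum>k<n. if i = k then w i * w k * (d - e) else 0)
        = (d - e) * (\<Sum>i<n. (w i)\<^sup>2)"
      by (simp add: power2_eq_square sum_distrib_left mult_ac)
    ultimately show ?thesis
      by (simp add: sum.distrib)
  qed
  also have "\<dots> = fact n * ((\<Sum>i<n. w i)\<^sup>2 * (S / n)\<^sup>2
      + (n * (\<Sum>i<n. (w i)\<^sup>2) - (\<Sum>i<n. w i)\<^sup>2) / (real n * (real n - 1)) * (q - S\<^sup>2 / n))"
  proof -
    have "(F * (S\<^sup>2 - q) / (r * (r - 1))) * W\<^sup>2 + (F * q / r - F * (S\<^sup>2 - q) / (r * (r - 1))) * V
        = F * (W\<^sup>2 * (S / r)\<^sup>2 + (r * V - W\<^sup>2) / (r * (r - 1)) * (q - S\<^sup>2 / r))"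
      if "r \<noteq> 0" "r - 1 \<noteq> 0" for F r W V :: real
      using that by (simp add: power_divide divide_simps) algebra
    from this[of "real n"] show ?thesis
      using n unfolding d_def e_def by simp
  qed
  finally show ?thesis .
qed

text \<open>
  The average is a symmetric quadratic form in \<open>x\<close>, hence a combination of the squared mean of \<open>x\<close>
  and the squared norm of the part of \<open>x\<close> orthogonal to the constants. The first is multiplied by the
  squared total weight and the second by a multiple of the variance of the weights. A multiple
  \<open>c\<close> of the coordinate sum shifts all weights by \<open>c\<close>, which leaves their variance alone; keeping \<open>c\<close>
  separate lets one use weights \<open>w\<close> whose squares are easy to sum.
\<close>

lemma sum_orders_affine_square:
  fixes x :: "'b \<Rightarrow> real" and w :: "nat \<Rightarrow> real"
  assumes A: "finite A" and n: "card A = n" "n \<ge> 2"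
  defines "S \<equiv> \<Sum>a\<in>A. x a" and "q \<equiv> \<Sum>a\<in>A. (x a)\<^sup>2"
  shows "(\<Sum>ys\<in>permutations_of_set A. (c * S + (\<Sum>i<n. w i * x (ys ! i)))\<^sup>2)
       = fact n * ((n * c + (\<Sum>i<n. w i))\<^sup>2 * (S / n)\<^sup>2
           + (n * (\<Sum>i<n. (w i)\<^sup>2) - (\<Sum>i<n. w i)\<^sup>2) / (real n * (real n - 1)) * (q - S\<^sup>2 / n))"
proof -
  have "(\<Sum>ys\<in>permutations_of_set A. (c * S + (\<Sum>i<n. w i * x (ys ! i)))\<^sup>2)
      = (\<Sum>ys\<in>permutations_of_set A. (\<Sum>i<n. (c + w i) * x (ys ! i))\<^sup>2)"
  proof (intro sum.cong refl)
    fix ys assume "ys \<in> permutations_of_set A"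
    then have "S = (\<Sum>i<n. x (ys ! i))"
      using sum_over_positions[of ys A x] n by (simp add: S_def)
    then show "(c * S + (\<Sum>i<n. w i * x (ys ! i)))\<^sup>2 = (\<Sum>i<n. (c + w i) * x (ys ! i))\<^sup>2"
      by (simp add: algebra_simps sum.distrib sum_distrib_left)
  qed
  moreover have "(\<Sum>i<n. c + w i) = n * c + (\<Sum>i<n. w i)"
    by (simp add: sum.distrib)
  moreover have "(\<Sum>i<n. (c + w i)\<^sup>2) = n * c\<^sup>2 + 2 * c * (\<Sum>i<n. w i) + (\<Sum>i<n. (w i)\<^sup>2)"
    by (simp add: power2_sum sum.distrib sum_distrib_left mult_ac)
  moreover have "n * (n * c\<^sup>2 + 2 * c * (\<Sum>i<n. w i) + (\<Sum>i<n. (w i)\<^sup>2)) - (n * c + (\<Sum>i<n. w i))\<^sup>2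
      = n * (\<Sum>i<n. (w i)\<^sup>2) - (\<Sum>i<n. w i)\<^sup>2"
    by (simp add: power2_eq_square algebra_simps)
  ultimately show ?thesis
    using sum_orders_linear_square[OF A n, of "\<lambda>i. c + w i" x] by (simp add: S_def q_def)
qed

section \<open>A single sweep through the coordinates\<close>

lemma cd_step_hess_nth:
  fixes x :: "real^'n"
  shows "cd_step (hess \<alpha>) i x $ a = (if a = i then x $ a - (hess \<alpha> *v x) $ i else x $ a)"
  by (simp add: cd_step_def hess_nth axis_def)

text \<open>
  The partial derivative along the coordinate about to be updated in step \<open>j\<close> of a sweep, written in
  terms of the point \<open>x\<close> at which the sweep started.
\<close>

definition sweep_grad :: "real \<Rightarrow> 'n list \<Rightarrow> real^'n::finite \<Rightarrow> nat \<Rightarrow> real" where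
  "sweep_grad \<alpha> ys x j = (1 + \<alpha>) * x $ (ys ! j)
     - \<alpha> * ((1 + \<alpha>) ^ j * (\<Sum>a\<in>UNIV. x $ a) - (\<Sum>i<j. (1 + \<alpha>) ^ (j - i) * x $ (ys ! i)))"

lemma sum_split_at:
  fixes F :: "'n::finite \<Rightarrow> real"
  shows "(\<Sum>a\<in>UNIV. F a) = F b + (\<Sum>a\<in>UNIV - {b}. F a)"
  by (simp add: sum.remove)

lemma sum_cd_step_hess:
  fixes x :: "real^'n"
  shows "(\<Sum>a\<in>UNIV. cd_step (hess \<alpha>) i x $ a) = (1 + \<alpha>) * ((\<Sum>a\<in>UNIV. x $ a) - x $ i)"
  unfolding sum_split_at[of "\<lambda>a. cd_step (hess \<alpha>) i x $ a" i]
  by (simp add: cd_step_hess_nth hess_mult_nth sum_split_at[of "($) x" i] algebra_simps)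

lemma norm_squared_eq_sum:
  fixes z :: "real^'n"
  shows "(norm z)\<^sup>2 = (\<Sum>a\<in>UNIV. (z $ a)\<^sup>2)"
  by (simp only: power2_norm_eq_inner inner_vec_def) (simp add: power2_eq_square)

lemma norm_cd_step_hess:
  fixes x :: "real^'n"
  shows "(norm (cd_step (hess \<alpha>) i x))\<^sup>2
       = (norm x)\<^sup>2 - (x $ i)\<^sup>2 + (x $ i - (hess \<alpha> *v x) $ i)\<^sup>2"
  unfolding norm_squared_eq_sum sum_split_at[of "\<lambda>a. (cd_step (hess \<alpha>) i x $ a)\<^sup>2" i]
      sum_split_at[of "\<lambda>a. (x $ a)\<^sup>2" i]
    by (simp add: cd_step_hess_nth)

lemma quad_cd_step_hess:
  fixes x :: "real^'n"
  shows "quad (hess \<alpha>) (cd_step (hess \<alpha>) i x) = quad (hess \<alpha>) x - ((hess \<alpha> *v x) $ i)\<^sup>2 / 2"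
  unfolding quad_def quad_hess norm_cd_step_hess sum_cd_step_hess
  by (simp add: hess_mult_nth) algebra

text \<open>
  A step sees the other coordinates only through their sum, and each step sends the sum \<open>s\<close> to
  \<open>(1 + \<alpha>) (s - x\<^sub>i)\<close>. Since a coordinate keeps its initial value until its turn comes, this linear
  recursion can be solved in terms of the starting point.
\<close>

lemma sweep_coordinate_sum:
  fixes x :: "real^'n" and \<alpha> :: real
  assumes "distinct ys" "j \<le> length ys"
  defines "X \<equiv> \<lambda>j. fold (cd_step (hess \<alpha>)) (take j ys) x"
  shows "(\<Sum>a\<in>UNIV. X j $ a)
       = (1 + \<alpha>) ^ j * (\<Sum>a\<in>UNIV. x $ a) - (\<Sum>i<j. (1 + \<alpha>) ^ (j - i) * x $ (ys ! i))
     \<and> (\<forall>a. a \<notin> set (take j ys) \<longrightarrow> X j $ a = x $ a)"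
  using assms(2)
proof (induction j)
  case 0
  then show ?case by (simp add: X_def)
next
  case (Suc j)
  have X: "X (Suc j) = cd_step (hess \<alpha>) (ys ! j) (X j)"
    using Suc.prems by (simp add: X_def take_Suc_conv_app_nth)
  have "ys ! j \<notin> set (take j ys)"
    using assms(1) Suc.prems by (auto simp: in_set_conv_nth nth_eq_iff_index_eq)
  then have old: "X j $ (ys ! j) = x $ (ys ! j)"
    using Suc by simp
  have "(\<Sum>i<j. (1 + \<alpha>) ^ (Suc j - i) * x $ (ys ! i))
      = (1 + \<alpha>) * (\<Sum>i<j. (1 + \<alpha>) ^ (j - i) * x $ (ys ! i))"
    unfolding sum_distrib_left by (intro sum.cong refl) (simp add: Suc_diff_le)
  moreover have "X (Suc j) $ a = x $ a" if "a \<notin> set (take (Suc j) ys)" for a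
    using Suc that by (auto simp: X cd_step_hess_nth take_Suc_conv_app_nth)
  moreover have "(\<Sum>a\<in>UNIV. X j $ a)
      = (1 + \<alpha>) ^ j * (\<Sum>a\<in>UNIV. x $ a) - (\<Sum>i<j. (1 + \<alpha>) ^ (j - i) * x $ (ys ! i))"
    using Suc by simp
  ultimately show ?case
    by (simp add: X sum_cd_step_hess old right_diff_distrib)
qed

lemma sweep_gradient:
  fixes x :: "real^'n" and \<alpha> :: real
  assumes "distinct ys" "j < length ys"
  defines "X \<equiv> fold (cd_step (hess \<alpha>)) (take j ys) x"
  shows "X $ (ys ! j) = x $ (ys ! j)" "(hess \<alpha> *v X) $ (ys ! j) = sweep_grad \<alpha> ys x j"
proof -
  have "ys ! j \<notin> set (take j ys)"
    using assms(1,2) by (auto simp: in_set_conv_nth nth_eq_iff_index_eq)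
  then show old: "X $ (ys ! j) = x $ (ys ! j)"
    using sweep_coordinate_sum[of ys j] assms by simp
  show "(hess \<alpha> *v X) $ (ys ! j) = sweep_grad \<alpha> ys x j"
    using sweep_coordinate_sum[of ys j \<alpha> x] assms
    unfolding hess_mult_nth old sweep_grad_def by simp
qed

text \<open>
  Every coordinate is changed exactly once, by the derivative met at that moment.
\<close>

lemma norm_sweep:
  fixes x :: "real^'n"
  assumes "ys \<in> permutations_of_set UNIV"
  shows "(norm (fold (cd_step (hess \<alpha>)) ys x))\<^sup>2
       = (\<Sum>j<CARD('n). (x $ (ys ! j) - sweep_grad \<alpha> ys x j)\<^sup>2)"
proof -
  have d: "distinct ys" "set ys = UNIV" and len: "length ys = CARD('n)"
    using assms by (auto simp: permutations_of_set_def length_finite_permutations_of_set)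
  have "(norm (fold (cd_step (hess \<alpha>)) (take j ys) x))\<^sup>2
      = (norm x)\<^sup>2 - (\<Sum>i<j. (x $ (ys ! i))\<^sup>2) + (\<Sum>i<j. (x $ (ys ! i) - sweep_grad \<alpha> ys x i)\<^sup>2)"
    if "j \<le> length ys" for j
    using that
    by (induction j) (simp_all add: take_Suc_conv_app_nth norm_cd_step_hess sweep_gradient[OF d(1)])
  from this[of "length ys"] have "(norm (fold (cd_step (hess \<alpha>)) ys x))\<^sup>2
      = (norm x)\<^sup>2 - (\<Sum>i<CARD('n). (x $ (ys ! i))\<^sup>2)
        + (\<Sum>i<CARD('n). (x $ (ys ! i) - sweep_grad \<alpha> ys x i)\<^sup>2)"
    by (simp add: len)
  moreover have "(\<Sum>i<CARD('n). (x $ (ys ! i))\<^sup>2) = (norm x)\<^sup>2"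
  proof -
    have "bij_betw ((!) ys) {..<CARD('n)} UNIV"
      using bij_betw_nth[of ys "{..<CARD('n)}" UNIV] d len by simp
    from sum.reindex_bij_betw[OF this, of "\<lambda>a. (x $ a)\<^sup>2"] show ?thesis
      by (simp add: norm_squared_eq_sum)
  qed
  ultimately show ?thesis by simp
qed

lemma quad_sweep:
  fixes x :: "real^'n"
  assumes "ys \<in> permutations_of_set UNIV"
  shows "quad (hess \<alpha>) (fold (cd_step (hess \<alpha>)) ys x)
       = quad (hess \<alpha>) x - (\<Sum>j<CARD('n). (sweep_grad \<alpha> ys x j)\<^sup>2) / 2"
proof -
  have d: "distinct ys" and len: "length ys = CARD('n)"
    using assms by (auto simp: permutations_of_set_def length_finite_permutations_of_set)
  have "quad (hess \<alpha>) (fold (cd_step (hess \<alpha>)) (take j ys) x)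
      = quad (hess \<alpha>) x - (\<Sum>i<j. (sweep_grad \<alpha> ys x i)\<^sup>2) / 2"
    if "j \<le> length ys" for j
    using that
    by (induction j) (simp_all add: take_Suc_conv_app_nth quad_cd_step_hess sweep_gradient[OF d] add_divide_distrib)
  from this[of "length ys"] show ?thesis
    by (simp add: len)
qed

section \<open>Geometric sums\<close>

lemma sum_square_geometric:
  fixes b :: real
  shows "(b\<^sup>2 - 1) * (\<Sum>k<n. b ^ (2 * k)) = b ^ (2 * n) - 1"
  using power_diff_1_eq[of "b\<^sup>2" n] by (simp add: power_mult)

lemma sum_square_powers:
  fixes \<alpha> :: real
  assumes "0 < \<alpha>"
  shows "(\<Sum>k<n. (1 + \<alpha>) ^ (2 * k)) = ((1 + \<alpha>) ^ (2 * n) - 1) / (\<alpha> * (\<alpha> + 2))"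
proof -
  have "(1 + \<alpha>)\<^sup>2 - 1 = \<alpha> * (\<alpha> + 2)"
    by (simp add: power2_eq_square algebra_simps)
  with sum_square_geometric[of "1 + \<alpha>" n] assms show ?thesis
    by (simp add: eq_divide_eq mult.commute)
qed

lemma sum_squares_mean_factor:
  fixes \<alpha> \<mu> :: real
  assumes "0 < \<alpha>"
  shows "(\<Sum>j<n. (1 - (1 + \<alpha>) ^ j * \<mu>)\<^sup>2)
       = n - 2 * \<mu> * (((1 + \<alpha>) ^ n - 1) / \<alpha>)
         + \<mu>\<^sup>2 * (((1 + \<alpha>) ^ (2 * n) - 1) / (\<alpha> * (\<alpha> + 2)))"
proof -
  have "(\<Sum>j<n. (1 - (1 + \<alpha>) ^ j * \<mu>)\<^sup>2)
      = (\<Sum>j<n. 1 - 2 * \<mu> * (1 + \<alpha>) ^ j + \<mu>\<^sup>2 * (1 + \<alpha>) ^ (2 * j))"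
    by (intro sum.cong refl)
      (simp add: power2_diff power_mult_distrib power_mult[symmetric] mult_ac)
  also have "\<dots> = n - 2 * \<mu> * (\<Sum>j<n. (1 + \<alpha>) ^ j) + \<mu>\<^sup>2 * (\<Sum>j<n. (1 + \<alpha>) ^ (2 * j))"
    by (simp add: sum.distrib sum_subtractf sum_distrib_left)
  also have "(\<Sum>j<n. (1 + \<alpha>) ^ j) = ((1 + \<alpha>) ^ n - 1) / \<alpha>"
    using geometric_sum[of "1 + \<alpha>" n] assms by simp
  finally show ?thesis
    unfolding sum_square_powers[OF assms] .
qed

text \<open>
  With \<open>w = 2 b - 1 \<le> b\<^sup>2\<close>, expand the left-hand side into the sums of \<open>b\<^sup>2\<^sup>k\<close> over \<open>1 \<le> k \<le> n\<close> and of
  \<open>w b\<^sup>2\<^sup>k\<close> over \<open>0 \<le> k < n\<close>, and run through the second one backwards: then the \<open>k\<close>-th terms satisfy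
  \<open>b\<^sup>2\<^sup>k + w b\<^bsup>2(n-k)\<^esup> \<le> b\<^sup>2\<^sup>n + w\<close>, because \<open>w (u - 1) \<le> b\<^sup>2\<^sup>k (u - 1)\<close> for \<open>u = b\<^bsup>2(n-k)\<^esup> \<ge> 1\<close>.
\<close>

lemma geometric_mean_inequality:
  fixes b :: real
  assumes b: "b \<ge> 1"
  shows "(b\<^sup>2 + 2 * b - 1) * (\<Sum>k<n. b ^ (2 * k)) \<le> n * (b ^ (2 * n) + 2 * b - 1)"
proof -
  define w where "w = 2 * b - 1"
  have w: "0 \<le> w" "w \<le> b\<^sup>2"
    using b zero_le_power2[of "b - 1"] by (auto simp: w_def power2_eq_square algebra_simps)
  have "b\<^sup>2 * (\<Sum>k<n. b ^ (2 * k)) = (\<Sum>k<n. b ^ (2 * Suc k))"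
    by (simp add: sum_distrib_left power2_eq_square mult_ac)
  moreover have "w * (\<Sum>k<n. b ^ (2 * k)) = (\<Sum>k<n. w * b ^ (2 * (n - Suc k)))"
    by (simp add: sum_distrib_left sum.nat_diff_reindex[of "\<lambda>k. w * b ^ (2 * k)" n])
  ultimately have "(b\<^sup>2 + w) * (\<Sum>k<n. b ^ (2 * k))
      = (\<Sum>k<n. b ^ (2 * Suc k) + w * b ^ (2 * (n - Suc k)))"
    by (simp add: algebra_simps sum.distrib)
  also have "\<dots> \<le> (\<Sum>k<n. b ^ (2 * n) + w)"
  proof (intro sum_mono)
    fix k assume k: "k \<in> {..<n}"
    define u where "u = b ^ (2 * (n - Suc k))"
    have "1 \<le> u" "1 \<le> b ^ (2 * k)"
      using b by (auto simp: u_def)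
    have "b ^ (2 * n) = b ^ (2 * Suc k) * u"
      using k unfolding u_def power_add[symmetric] by (intro arg_cong[where f = "(^) b"]) auto
    moreover have "w \<le> b ^ (2 * Suc k)"
      using w mult_mono[of w "b\<^sup>2" 1 "b ^ (2 * k)"] \<open>1 \<le> b ^ (2 * k)\<close>
      by (simp add: power_add power2_eq_square)
    then have "w * (u - 1) \<le> b ^ (2 * Suc k) * (u - 1)"
      using \<open>1 \<le> u\<close> by (intro mult_right_mono) auto
    ultimately show "b ^ (2 * Suc k) + w * b ^ (2 * (n - Suc k)) \<le> b ^ (2 * n) + w"
      unfolding u_def[symmetric] by (simp add: algebra_simps)
  qed
  finally show ?thesis
    by (simp add: w_def algebra_simps)
qed

section \<open>Contraction of the average over one sweep\<close>

lemma sum_square_le_card_norm: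
  fixes x :: "real^'n"
  shows "(\<Sum>a\<in>UNIV. x $ a)\<^sup>2 / CARD('n) \<le> (norm x)\<^sup>2"
  using sum_squared_le_sum_of_squares[of "($) x" UNIV]
  by (simp add: norm_squared_eq_sum divide_le_eq)

lemma sum_if_le:
  fixes f :: "nat \<Rightarrow> real"
  assumes "j < n"
  shows "(\<Sum>i<n. if i \<le> j then f i else 0) = (\<Sum>i<Suc j. f i)"
proof -
  have "{i. i < n \<and> i \<le> j} = {..<Suc j}"
    using assms by auto
  then show ?thesis
    by (simp add: sum.inter_filter[symmetric])
qed

text \<open>
  A step replaces a coordinate by \<open>\<alpha>\<close> times the sum of the others, so every coordinate after the sweep
  is a combination of the initial ones with nonnegative weights. The weights of the \<open>j\<close>-th visited
  coordinate add up to its value when the sweep starts from the all-ones vector, which is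
  \<open>1 - (1 + \<alpha>)\<^sup>j \<mu>\<close>.
\<close>

lemma sum_sweep_norm_le:
  fixes x :: "real^'n"
  assumes \<alpha>: "0 < \<alpha>" and n: "n = CARD('n)" "n \<ge> 2"
    and \<mu>: "\<mu> = 1 - \<alpha> * (real n - 1)"
  shows "(\<Sum>ys\<in>permutations_of_set UNIV. (norm (fold (cd_step (hess \<alpha>)) ys x))\<^sup>2)
       \<le> fact n * ((\<Sum>j<n. (1 - (1 + \<alpha>) ^ j * \<mu>)\<^sup>2) / n * (norm x)\<^sup>2)"
proof -
  define b where "b = 1 + \<alpha>"
  define S where "S = (\<Sum>a\<in>UNIV. x $ a)"
  define w where "w j i = (if i \<le> j then \<alpha> * b ^ (j - i) else 0)" for i j :: nat
  define u where "u j i = \<alpha> * b ^ j - w j i" for i j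
  have u_nonneg: "0 \<le> u j i" for i j
    using \<alpha> by (simp add: u_def w_def b_def power_increasing)
  have y: "x $ (ys ! j) - sweep_grad \<alpha> ys x j = (\<Sum>i<n. u j i * x $ (ys ! i))"
    if "j < n" "ys \<in> permutations_of_set UNIV" for j ys
  proof -
    have "(\<Sum>i<n. w j i * x $ (ys ! i)) = (\<Sum>i<n. if i \<le> j then \<alpha> * b ^ (j - i) * x $ (ys ! i) else 0)"
      by (intro sum.cong) (auto simp: w_def)
    also have "\<dots> = \<alpha> * (\<Sum>i<j. b ^ (j - i) * x $ (ys ! i)) + \<alpha> * x $ (ys ! j)"
      using that by (simp add: sum_if_le sum_distrib_left mult.assoc)
    finally have "(\<Sum>i<n. w j i * x $ (ys ! i))
        = \<alpha> * (\<Sum>i<j. b ^ (j - i) * x $ (ys ! i)) + \<alpha> * x $ (ys ! j)" .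
    moreover have "S = (\<Sum>i<n. x $ (ys ! i))"
      using sum_over_positions[OF that(2), of "($) x"] by (simp add: S_def n(1))
    then have "\<alpha> * b ^ j * S = (\<Sum>i<n. \<alpha> * b ^ j * x $ (ys ! i))"
      by (simp add: sum_distrib_left)
    ultimately show ?thesis
      by (simp add: sweep_grad_def u_def left_diff_distrib sum_subtractf b_def S_def algebra_simps)
  qed
  have total: "(\<Sum>i<n. u j i) = 1 - b ^ j * \<mu>" if "j < n" for j
  proof -
    have "(\<Sum>i<n. w j i) = (\<Sum>i<Suc j. \<alpha> * b ^ (j - i))"
      unfolding w_def by (rule sum_if_le[OF that])
    also have "\<dots> = (b - 1) * (\<Sum>m<Suc j. b ^ m)"
      using sum.nat_diff_reindex[of "\<lambda>m. b ^ m" "Suc j"]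
      by (simp add: b_def sum_distrib_left[symmetric] del: sum.lessThan_Suc)
    also have "\<dots> = b ^ Suc j - 1"
      by (simp only: power_diff_1_eq)
    finally show ?thesis
      by (simp add: u_def sum_subtractf \<mu> b_def algebra_simps)
  qed
  have "(\<Sum>ys\<in>permutations_of_set UNIV. (norm (fold (cd_step (hess \<alpha>)) ys x))\<^sup>2)
      = (\<Sum>j<n. \<Sum>ys\<in>permutations_of_set UNIV. (\<Sum>i<n. u j i * x $ (ys ! i))\<^sup>2)"
    by (subst sum.swap) (simp add: norm_sweep y n(1))
  also have "\<dots> \<le> (\<Sum>j<n. fact n * ((1 - b ^ j * \<mu>)\<^sup>2 / n * (norm x)\<^sup>2))"
  proof (rule sum_mono)
    fix j assume "j \<in> {..<n}"
    then show "(\<Sum>ys\<in>permutations_of_set UNIV. (\<Sum>i<n. u j i * x $ (ys ! i))\<^sup>2)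
        \<le> fact n * ((1 - b ^ j * \<mu>)\<^sup>2 / n * (norm x)\<^sup>2)"
      using sum_orders_nonneg_weights_le[OF finite n(1)[symmetric], of "u j" "($) x"] u_nonneg
      by (simp add: total norm_squared_eq_sum)
  qed
  finally show ?thesis
    by (simp only: b_def sum_distrib_left[symmetric] sum_distrib_right[symmetric] sum_divide_distrib[symmetric])
qed

text \<open>
  A sweep decreases the objective by half the sum of the squared partial derivatives used, so a lower
  bound for their average is wanted. The objective is
  \<open>((1 + \<alpha>) V + \<mu> S\<^sup>2 / n) / 2\<close>, with \<open>S\<close> the coordinate sum and \<open>V\<close> the squared norm of the part
  of \<open>x\<close> orthogonal to the constants. On the constants the stated factor is attained, and on the
  orthogonal part it is a bound by \<open>geometric_mean_inequality\<close>.
\<close>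

lemma sum_sweep_quad_le:
  fixes x :: "real^'n"
  assumes \<alpha>: "0 < \<alpha>" and n: "n = CARD('n)" "n \<ge> 2"
    and \<mu>: "\<mu> = 1 - \<alpha> * (real n - 1)"
  shows "(\<Sum>ys\<in>permutations_of_set UNIV. quad (hess \<alpha>) (fold (cd_step (hess \<alpha>)) ys x))
       \<le> fact n * ((1 - \<mu> / n * (\<Sum>j<n. (1 + \<alpha>) ^ (2 * j))) * quad (hess \<alpha>) x)"
proof -
  define b where "b = 1 + \<alpha>"
  define S where "S = (\<Sum>a\<in>UNIV. x $ a)"
  define V where "V = (norm x)\<^sup>2 - S\<^sup>2 / n"
  define Q where "Q j = (\<Sum>m<j. b ^ (2 * m))" for j :: nat
  define w where "w j i = (if i \<le> j then (if i = j then b else \<alpha> * b ^ (j - i)) else 0)" for i j :: nat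
  have V: "V \<ge> 0"
    using sum_square_le_card_norm[of x] by (simp add: V_def S_def n)
  have g: "sweep_grad \<alpha> ys x j = - \<alpha> * b ^ j * S + (\<Sum>i<n. w j i * x $ (ys ! i))"
    if "j < n" for j ys
  proof -
    have "(\<Sum>i<n. w j i * x $ (ys ! i))
        = (\<Sum>i<n. if i \<le> j then (if i = j then b else \<alpha> * b ^ (j - i)) * x $ (ys ! i) else 0)"
      by (intro sum.cong) (auto simp: w_def)
    also have "\<dots> = \<alpha> * (\<Sum>i<j. b ^ (j - i) * x $ (ys ! i)) + b * x $ (ys ! j)"
      using that by (simp add: sum_if_le sum_distrib_left mult.assoc)
    finally show ?thesis
      by (simp add: sweep_grad_def b_def S_def algebra_simps)
  qed
  have flip: "(\<Sum>i<j. b ^ (j - i)) = b * (\<Sum>m<j. b ^ m)" "(\<Sum>i<j. (b ^ (j - i))\<^sup>2) = b\<^sup>2 * Q j" for j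
  proof -
    have "(\<Sum>i<j. f (j - i)) = (\<Sum>m<j. f (Suc m))" for f :: "nat \<Rightarrow> real"
    proof -
      have "(\<Sum>i<j. f (j - i)) = (\<Sum>i<j. f (Suc (j - Suc i)))"
        by (intro sum.cong refl) (auto simp: Suc_diff_Suc)
      then show ?thesis
        using sum.nat_diff_reindex[of "\<lambda>m. f (Suc m)" j] by simp
    qed
    from this[of "\<lambda>m. b ^ m"] this[of "\<lambda>m. (b ^ m)\<^sup>2"]
    show "(\<Sum>i<j. b ^ (j - i)) = b * (\<Sum>m<j. b ^ m)" "(\<Sum>i<j. (b ^ (j - i))\<^sup>2) = b\<^sup>2 * Q j"
      by (simp_all add: Q_def sum_distrib_left power_mult_distrib power_mult[symmetric] mult.commute)
  qed
  have w1: "(\<Sum>i<n. w j i) = b ^ Suc j" and w2: "(\<Sum>i<n. (w j i)\<^sup>2) = b\<^sup>2 * (1 + \<alpha>\<^sup>2 * Q j)"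
    if "j < n" for j
  proof -
    have "(\<Sum>i<n. w j i) = \<alpha> * (\<Sum>i<j. b ^ (j - i)) + b"
      using that by (simp add: w_def sum_if_le sum_distrib_left)
    also have "\<dots> = b * ((b - 1) * (\<Sum>m<j. b ^ m) + 1)"
      unfolding flip by (simp add: b_def algebra_simps)
    also have "\<dots> = b ^ Suc j"
      by (simp add: power_diff_1_eq[symmetric])
    finally show "(\<Sum>i<n. w j i) = b ^ Suc j" .
    have "(\<Sum>i<n. (w j i)\<^sup>2) = (\<Sum>i<n. if i \<le> j then (if i = j then b\<^sup>2 else (\<alpha> * b ^ (j - i))\<^sup>2) else 0)"
      by (intro sum.cong) (auto simp: w_def)
    also have "\<dots> = \<alpha>\<^sup>2 * (\<Sum>i<j. (b ^ (j - i))\<^sup>2) + b\<^sup>2"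
      using that by (simp add: sum_if_le sum_distrib_left power_mult_distrib)
    finally show "(\<Sum>i<n. (w j i)\<^sup>2) = b\<^sup>2 * (1 + \<alpha>\<^sup>2 * Q j)"
      unfolding flip by (simp add: algebra_simps)
  qed
  have c: "n * (- \<alpha> * b ^ j) + b ^ Suc j = b ^ j * \<mu>" for j
    by (simp add: \<mu> b_def algebra_simps)
  let ?G = "\<Sum>j<n. n * (b\<^sup>2 * (1 + \<alpha>\<^sup>2 * Q j)) - (b ^ Suc j)\<^sup>2"
  have geo: "(b\<^sup>2 - 1) * Q j = b ^ (2 * j) - 1" for j
    using sum_square_geometric[of b j] by (simp add: Q_def)
  have spread: "(real n - 1) * (b * \<mu> * Q n) \<le> ?G"
  proof -
    define T where "T = (\<Sum>j<n. Q j)"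
    have "?G = (\<Sum>j<n. b\<^sup>2 * n + n * b\<^sup>2 * \<alpha>\<^sup>2 * Q j - b\<^sup>2 * b ^ (2 * j))"
      by (intro sum.cong refl) (simp add: algebra_simps power_mult power2_eq_square power_mult_distrib)
    also have "\<dots> = b\<^sup>2 * ((real n)\<^sup>2 + n * \<alpha>\<^sup>2 * T - Q n)"
      by (simp add: sum.distrib sum_subtractf sum_distrib_left[symmetric] T_def Q_def[of n]
          power2_eq_square algebra_simps)
    finally have G: "?G = b\<^sup>2 * ((real n)\<^sup>2 + n * \<alpha>\<^sup>2 * T - Q n)" .
    have "(b\<^sup>2 - 1) * T = Q n - n"
      unfolding T_def sum_distrib_left geo by (simp add: sum_subtractf Q_def)
    moreover have "(\<alpha> + 2) * (\<alpha>\<^sup>2 * T) = \<alpha> * ((b\<^sup>2 - 1) * T)"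
      by (simp add: b_def power2_eq_square algebra_simps)
    ultimately have T: "(\<alpha> + 2) * (\<alpha>\<^sup>2 * T) = \<alpha> * (Q n - n)"
      by simp
    \<comment> \<open>Multiplied by \<open>(\<alpha> + 2) / b\<close>, the difference of the two sides of the claim is \<open>n\<close> times the slack
       in \<open>geometric_mean_inequality\<close>.\<close>
    have "(b\<^sup>2 + 2 * b - 1) * Q n \<le> n * ((b\<^sup>2 - 1) * Q n + 2 * b)"
      using geometric_mean_inequality[of b n] \<alpha> unfolding geo by (simp add: b_def Q_def)
    then have "0 \<le> n * (n * ((b\<^sup>2 - 1) * Q n + 2 * b) - (b\<^sup>2 + 2 * b - 1) * Q n)"
      by simp
    also have "\<dots> = b * ((\<alpha> + 2) * (real n)\<^sup>2 + n * (\<alpha> * (Q n - n)) - (\<alpha> + 2) * Q n)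
        - (\<alpha> + 2) * ((real n - 1) * (\<mu> * Q n))"
      by (simp add: b_def \<mu> power2_eq_square algebra_simps)
    also have "\<dots> = (\<alpha> + 2) * (b * ((real n)\<^sup>2 + n * \<alpha>\<^sup>2 * T - Q n) - (real n - 1) * (\<mu> * Q n))"
      unfolding T[symmetric] by (simp add: algebra_simps)
    finally have "(real n - 1) * (\<mu> * Q n) \<le> b * ((real n)\<^sup>2 + n * \<alpha>\<^sup>2 * T - Q n)"
      using \<alpha> by (simp add: zero_le_mult_iff)
    then have "b * ((real n - 1) * (\<mu> * Q n)) \<le> b * (b * ((real n)\<^sup>2 + n * \<alpha>\<^sup>2 * T - Q n))"
      using \<alpha> by (intro mult_left_mono) (auto simp: b_def)
    then show ?thesis
      unfolding G by (simp add: power2_eq_square algebra_simps)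
  qed
  have "(\<Sum>ys\<in>permutations_of_set UNIV. \<Sum>j<n. (sweep_grad \<alpha> ys x j)\<^sup>2)
      = (\<Sum>j<n. \<Sum>ys\<in>permutations_of_set UNIV. (- \<alpha> * b ^ j * S + (\<Sum>i<n. w j i * x $ (ys ! i)))\<^sup>2)"
    by (subst sum.swap) (simp add: g)
  also have "\<dots> = (\<Sum>j<n. fact n * ((b ^ j * \<mu>)\<^sup>2 * (S / n)\<^sup>2
      + (n * (b\<^sup>2 * (1 + \<alpha>\<^sup>2 * Q j)) - (b ^ Suc j)\<^sup>2) / (real n * (real n - 1)) * V))"
  proof (intro sum.cong refl)
    fix j assume "j \<in> {..<n}"
    then have "j < n" by simp
    show "(\<Sum>ys\<in>permutations_of_set UNIV. (- \<alpha> * b ^ j * S + (\<Sum>i<n. w j i * x $ (ys ! i)))\<^sup>2)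
        = fact n * ((b ^ j * \<mu>)\<^sup>2 * (S / n)\<^sup>2
      + (n * (b\<^sup>2 * (1 + \<alpha>\<^sup>2 * Q j)) - (b ^ Suc j)\<^sup>2) / (real n * (real n - 1)) * V)"
      using sum_orders_affine_square[OF finite n(1)[symmetric] n(2), of "- \<alpha> * b ^ j" "($) x" "w j"]
      unfolding w1[OF \<open>j < n\<close>] w2[OF \<open>j < n\<close>] c S_def[symmetric] norm_squared_eq_sum[symmetric] V_def[symmetric] .
  qed
  also have "\<dots> = fact n * ((\<Sum>j<n. (b ^ j * \<mu>)\<^sup>2) * (S / n)\<^sup>2 + ?G / (real n * (real n - 1)) * V)"
    by (simp only: sum_distrib_left[symmetric] sum_distrib_right[symmetric] sum.distrib sum_divide_distrib[symmetric])
  also have "(\<Sum>j<n. (b ^ j * \<mu>)\<^sup>2) = \<mu>\<^sup>2 * Q n"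
    by (simp add: Q_def sum_distrib_left power_mult_distrib power_mult[symmetric] mult.commute)
  finally have decrease: "(\<Sum>ys\<in>permutations_of_set UNIV. \<Sum>j<n. (sweep_grad \<alpha> ys x j)\<^sup>2)
      = fact n * (\<mu>\<^sup>2 * Q n * (S / n)\<^sup>2 + ?G / (real n * (real n - 1)) * V)" .
  have "fact n * (\<mu> / n * Q n * (2 * quad (hess \<alpha>) x))
      = fact n * (\<mu>\<^sup>2 * Q n * (S / n)\<^sup>2 + (real n - 1) * (b * \<mu> * Q n) / (real n * (real n - 1)) * V)"
  proof -
    have "2 * quad (hess \<alpha>) x = b * V + \<mu> * (S\<^sup>2 / n)"
      using n(2) unfolding quad_def quad_hess
      by (simp add: V_def S_def b_def \<mu> field_simps)
    then show ?thesis
      using n(2) by (simp add: power_divide field_simps power2_eq_square)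
  qed
  also have "\<dots> \<le> fact n * (\<mu>\<^sup>2 * Q n * (S / n)\<^sup>2 + ?G / (real n * (real n - 1)) * V)"
    using spread V n by (intro mult_left_mono add_left_mono mult_right_mono divide_right_mono) auto
  also note decrease[symmetric]
  finally have le: "fact n * (\<mu> / n * Q n * (2 * quad (hess \<alpha>) x))
      \<le> (\<Sum>ys\<in>permutations_of_set UNIV. \<Sum>j<n. (sweep_grad \<alpha> ys x j)\<^sup>2)" .
  have "(\<Sum>ys\<in>permutations_of_set UNIV. quad (hess \<alpha>) (fold (cd_step (hess \<alpha>)) ys x))
      = fact n * quad (hess \<alpha>) x
        - (\<Sum>ys\<in>permutations_of_set UNIV. \<Sum>j<n. (sweep_grad \<alpha> ys x j)\<^sup>2) / 2"
    using n(1) by (simp add: quad_sweep sum_subtractf sum_divide_distrib)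
  also have "\<dots> \<le> fact n * quad (hess \<alpha>) x - fact n * (\<mu> / n * Q n * (2 * quad (hess \<alpha>) x)) / 2"
    using le by (intro diff_left_mono divide_right_mono) auto
  also have "\<dots> = fact n * ((1 - \<mu> / n * Q n) * quad (hess \<alpha>) x)"
    by (simp add: algebra_simps)
  finally show ?thesis
    by (simp add: Q_def b_def)
qed

section \<open>Expectation over independent epochs\<close>

text \<open>
  Each step has only finitely many continuations, although \<open>p\<close> ranges over infinitely many sequences
  of lists.
\<close>

lemma finite_range_rpcd:
  fixes A :: "real^'n^'n"
  shows "finite (range (\<lambda>p. rpcd A p x0 k))"
proof (induction k)
  case (Suc k)
  have "range (\<lambda>p. rpcd A p x0 (Suc k)) \<subseteq> (\<Union>i. cd_step A i ` range (\<lambda>p. rpcd A p x0 k))"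
    by auto
  moreover have "finite (\<Union>i. cd_step A i ` range (\<lambda>p. rpcd A p x0 k))"
    using Suc by simp
  ultimately show ?case
    by (rule finite_subset)
qed simp

lemma rpcd_cong:
  fixes A :: "real^'n^'n"
  assumes "\<And>m. m < l \<Longrightarrow> p m = p' m" and "k \<le> l * CARD('n)"
  shows "rpcd A p x0 k = rpcd A p' x0 k"
  using assms(2) by (induction k) (simp_all add: assms(1) div_less_iff_less_mult)

lemma measurable_rpcd:
  fixes A :: "real^'n^'n"
  assumes "k \<le> l * CARD('n)"
  shows "(\<lambda>p. rpcd A p x0 k) \<in> measurable (PiM {..<l} (\<lambda>_. count_space UNIV)) (count_space UNIV)"
  using assms
proof (induction k)
  case (Suc k)
  let ?M = "PiM {..<l} (\<lambda>_. count_space UNIV) :: (nat \<Rightarrow> 'n list) measure"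
  have "k div CARD('n) < l"
    using Suc.prems by (simp add: div_less_iff_less_mult)
  then have "(\<lambda>p. p (k div CARD('n))) \<in> measurable ?M (count_space UNIV)"
    by (intro measurable_component_singleton) auto
  then have i: "(\<lambda>p. p (k div CARD('n)) ! (k mod CARD('n))) \<in> measurable ?M (count_space UNIV)"
    by (rule measurable_compose) simp
  have X: "(\<lambda>p. cd_step A i (rpcd A p x0 k)) \<in> measurable ?M (count_space UNIV)" for i
    using Suc by (intro measurable_compose[OF _ measurable_count_space]) simp
  show ?case
    unfolding rpcd.simps
    by (rule measurable_compose_countable'[where I = UNIV and f = "\<lambda>i p. cd_step A i (rpcd A p x0 k)", OF X i])
      (simp add: countable_finite)
qed simp

lemma rpcd_epoch:
  fixes A :: "real^'n^'n"
  assumes "length (p l) = CARD('n)"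
  shows "rpcd A p x0 (Suc l * CARD('n)) = fold (cd_step A) (p l) (rpcd A p x0 (l * CARD('n)))"
proof -
  have "rpcd A p x0 (l * CARD('n) + j) = fold (cd_step A) (take j (p l)) (rpcd A p x0 (l * CARD('n)))"
    if "j \<le> CARD('n)" for j
    using that
  proof (induction j)
    case (Suc j)
    then have "(l * CARD('n) + j) div CARD('n) = l" "(l * CARD('n) + j) mod CARD('n) = j"
      by auto
    then show ?case
      using Suc assms by (simp add: take_Suc_conv_app_nth)
  qed simp
  from this[of "CARD('n)"] show ?thesis
    using assms by (simp add: add.commute)
qed

text \<open>
  The point reached after \<open>l\<close> epochs depends only on the first \<open>l\<close> orders and is therefore independent
  of the next one. Conditioning on the value of that next order reduces the expectation to the
  deterministic average over all orders. All functions involved are integrable because only finitely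
  many points can be reached in a given number of steps.
\<close>

lemma expectation_rpcd_le:
  fixes A :: "real^'n^'n" and F :: "real^'n \<Rightarrow> real"
  assumes \<pi>: "random_orders M \<pi>" and \<rho>: "0 \<le> \<rho>"
    and avg: "\<And>x. (\<Sum>ys\<in>permutations_of_set UNIV. F (fold (cd_step A) ys x)) \<le> fact CARD('n) * (\<rho> * F x)"
  shows "(LINT \<omega>|M. F (rpcd A (\<lambda>m. \<pi> m \<omega>) x0 (l * CARD('n)))) \<le> \<rho> ^ l * F x0"
proof -
  interpret prob_space M
    using \<pi> by (simp add: random_orders_def)
  have ind: "indep_vars (\<lambda>_. count_space UNIV) \<pi> UNIV"
    and dis: "distr M (count_space UNIV) (\<pi> m) = measure_pmf (pmf_of_set (permutations_of_set UNIV))" for m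
    using \<pi> by (auto simp: random_orders_def)
  have \<pi>_meas[measurable]: "\<pi> m \<in> measurable M (count_space UNIV)" for m
    using ind by (auto simp: indep_vars_def)
  define X where "X k \<omega> = rpcd A (\<lambda>m. \<pi> m \<omega>) x0 (k * CARD('n))" for k \<omega>
  have X_restrict: "X k \<omega> = rpcd A (\<lambda>m\<in>{..<k}. \<pi> m \<omega>) x0 (k * CARD('n))" for k \<omega>
    unfolding X_def by (rule rpcd_cong[where l = k]) auto
  have X_meas: "X k \<in> measurable M (count_space UNIV)" for k
  proof -
    have "(\<lambda>\<omega>. \<lambda>m\<in>{..<k}. \<pi> m \<omega>) \<in> measurable M (PiM {..<k} (\<lambda>_. count_space UNIV))"
      by (rule measurable_restrict) simp
    from measurable_compose[OF this measurable_rpcd[OF order.refl, of A x0]] show ?thesis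
      by (simp add: X_restrict[abs_def])
  qed
  have GX: "integrable M (\<lambda>\<omega>. G (X k \<omega>))" for G :: "real^'n \<Rightarrow> real" and k
  proof -
    let ?R = "range (\<lambda>p. rpcd A p x0 (k * CARD('n)))"
    have "norm (G (X k \<omega>)) \<le> Max ((\<lambda>x. norm (G x)) ` ?R)" for \<omega>
      unfolding X_def by (intro Max_ge finite_imageI finite_range_rpcd) blast
    moreover have "(\<lambda>\<omega>. G (X k \<omega>)) \<in> borel_measurable M"
      by (rule measurable_compose[OF X_meas]) simp
    ultimately show ?thesis
      by (intro integrable_const_bound) auto
  qed
  show ?thesis
  proof (induction l)
    case 0
    then show ?case by (simp add: prob_space)
  next
    case (Suc l)
    let ?U = "permutations_of_set (UNIV :: 'n set)"
    let ?I = "\<lambda>ys \<omega>. indicat_real {ys} (\<pi> l \<omega>)"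
    let ?F = "\<lambda>ys x. F (fold (cd_step A) ys x)"
    have U: "?U \<noteq> {}" "finite ?U"
      by simp_all
    have prod: "integrable M (\<lambda>\<omega>. ?I ys \<omega> * ?F ys (X l \<omega>))"
      "(LINT \<omega>|M. ?I ys \<omega> * ?F ys (X l \<omega>)) = (LINT \<omega>|M. ?I ys \<omega>) * (LINT \<omega>|M. ?F ys (X l \<omega>))"
      for ys
    proof -
      have "indep_var (PiM {l} (\<lambda>_. count_space UNIV)) (\<lambda>\<omega>. \<lambda>m\<in>{l}. \<pi> m \<omega>)
          (PiM {..<l} (\<lambda>_. count_space UNIV)) (\<lambda>\<omega>. \<lambda>m\<in>{..<l}. \<pi> m \<omega>)"
        by (rule indep_var_restrict[OF ind]) auto
      then have "indep_var borel ((\<lambda>p. indicat_real {ys} (p l)) \<circ> (\<lambda>\<omega>. \<lambda>m\<in>{l}. \<pi> m \<omega>))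
          borel ((\<lambda>p. ?F ys (rpcd A p x0 (l * CARD('n)))) \<circ> (\<lambda>\<omega>. \<lambda>m\<in>{..<l}. \<pi> m \<omega>))"
      proof (rule indep_var_compose)
        have "(\<lambda>p. p l) \<in> measurable (PiM {l} (\<lambda>_. count_space UNIV)) (count_space UNIV)"
          by (rule measurable_component_singleton) simp
        then show "(\<lambda>p. indicat_real {ys} (p l)) \<in> borel_measurable (PiM {l} (\<lambda>_. count_space UNIV))"
          by (rule measurable_compose) simp
        show "(\<lambda>p. ?F ys (rpcd A p x0 (l * CARD('n)))) \<in> borel_measurable (PiM {..<l} (\<lambda>_. count_space UNIV))"
          by (rule measurable_compose[OF measurable_rpcd[OF order.refl]]) simp
      qed
      then have ind2: "indep_var borel (?I ys) borel (\<lambda>\<omega>. ?F ys (X l \<omega>))"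
        by (simp add: o_def X_restrict)
      have I: "integrable M (?I ys)"
        by (intro integrable_const_bound[where B = 1]) (auto simp: indicator_def)
      note Fi = GX[of "?F ys" l]
      show "integrable M (\<lambda>\<omega>. ?I ys \<omega> * ?F ys (X l \<omega>))"
        by (rule indep_var_integrable[OF ind2 I Fi])
      show "(LINT \<omega>|M. ?I ys \<omega> * ?F ys (X l \<omega>)) = (LINT \<omega>|M. ?I ys \<omega>) * (LINT \<omega>|M. ?F ys (X l \<omega>))"
        by (rule indep_var_lebesgue_integral[OF ind2 I Fi])
    qed
    have unif: "(LINT \<omega>|M. ?I ys \<omega>) = 1 / fact CARD('n)" if "ys \<in> ?U" for ys
    proof -
      have "(LINT \<omega>|M. ?I ys \<omega>) = (LINT zs|distr M (count_space UNIV) (\<pi> l). indicat_real {ys} zs)"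
        by (rule integral_distr[symmetric]) simp_all
      also have "\<dots> = pmf (pmf_of_set ?U) ys"
        unfolding dis by (simp add: measure_pmf_single)
      finally show ?thesis
        using that U by simp
    qed
    \<comment> \<open>Outside a null set the list is an ordering of all coordinates, so exactly one of the indicators is 1.\<close>
    have "AE zs in distr M (count_space UNIV) (\<pi> l). zs \<in> ?U"
      unfolding dis using U by (simp add: AE_measure_pmf_iff)
    then have AE_U: "AE \<omega> in M. \<pi> l \<omega> \<in> ?U"
      by (simp add: AE_distr_iff)
    have "(LINT \<omega>|M. F (X (Suc l) \<omega>)) = (LINT \<omega>|M. (\<Sum>ys\<in>?U. ?I ys \<omega> * ?F ys (X l \<omega>)))"
    proof (rule integral_cong_AE)
      show "(\<lambda>\<omega>. F (X (Suc l) \<omega>)) \<in> borel_measurable M"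
        using GX by (rule borel_measurable_integrable)
      show "(\<lambda>\<omega>. \<Sum>ys\<in>?U. ?I ys \<omega> * ?F ys (X l \<omega>)) \<in> borel_measurable M"
        using prod(1) by (intro borel_measurable_sum borel_measurable_integrable)
      show "AE \<omega> in M. F (X (Suc l) \<omega>) = (\<Sum>ys\<in>?U. ?I ys \<omega> * ?F ys (X l \<omega>))"
        using AE_U
      proof eventually_elim
        case (elim \<omega>)
        have "(\<Sum>ys\<in>?U. ?I ys \<omega> * ?F ys (X l \<omega>)) = (\<Sum>ys\<in>?U. if \<pi> l \<omega> = ys then ?F ys (X l \<omega>) else 0)"
          by (intro sum.cong) (auto simp: indicator_def)
        also have "\<dots> = ?F (\<pi> l \<omega>) (X l \<omega>)"
          using elim U(2) by (simp add: sum.delta)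
        finally show ?case
          using rpcd_epoch[of "\<lambda>m. \<pi> m \<omega>" l A x0] elim
          by (simp add: X_def length_finite_permutations_of_set)
      qed
    qed
    also have "\<dots> = (\<Sum>ys\<in>?U. 1 / fact CARD('n) * (LINT \<omega>|M. ?F ys (X l \<omega>)))"
      using prod by (subst Bochner_Integration.integral_sum) (auto simp only: unif intro!: sum.cong)
    also have "\<dots> = (LINT \<omega>|M. (\<Sum>ys\<in>?U. ?F ys (X l \<omega>)) / fact CARD('n))"
      using GX[of "?F _" l] by (simp add: Bochner_Integration.integral_sum sum_divide_distrib)
    also have "\<dots> \<le> (LINT \<omega>|M. \<rho> * F (X l \<omega>))"
    proof (rule integral_mono)
      show "integrable M (\<lambda>\<omega>. (\<Sum>ys\<in>?U. ?F ys (X l \<omega>)) / fact CARD('n))"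
        "integrable M (\<lambda>\<omega>. \<rho> * F (X l \<omega>))"
        by (rule GX)+
      show "(\<Sum>ys\<in>?U. ?F ys (X l \<omega>)) / fact CARD('n) \<le> \<rho> * F (X l \<omega>)" for \<omega>
        using avg[of "X l \<omega>"] by (simp add: divide_le_eq mult.commute)
    qed
    also have "\<dots> = \<rho> * (LINT \<omega>|M. F (X l \<omega>))"
      by simp
    also have "\<dots> \<le> \<rho> * (\<rho> ^ l * F x0)"
      using Suc \<rho> by (intro mult_left_mono) (simp_all add: X_def)
    finally show ?case
      by (simp add: X_def mult.assoc)
  qed
qed

theorem proposition4p7:
  fixes M :: "'a measure"
    and \<pi> :: "nat \<Rightarrow> 'a \<Rightarrow> 'n::finite list"
    and A :: "real^'n^'n"
    and f :: "real^'n \<Rightarrow> real"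
    and x0 xstar :: "real^'n"
    and n l :: nat
    and \<alpha> \<mu> :: real
  assumes n: "n = CARD('n)" "n \<ge> 2"
    and \<alpha>: "0 < \<alpha>" "\<alpha> < 1 / (real n - 1)"
    and A: "A = hess \<alpha>"
    and f: "f = quad A"
    and \<mu>: "\<mu> = 1 - \<alpha> * (real n - 1)"
    and xstar: "xstar = 0"
    and \<pi>: "random_orders M \<pi>"
  shows "(LINT \<omega>|M. (norm (rpcd A (\<lambda>m. \<pi> m \<omega>) x0 (l * n) - xstar))\<^sup>2)
           \<le> (1 - 2 * \<mu> / real n * (((1 + \<alpha>) ^ n - 1) / \<alpha>)
                + \<mu>\<^sup>2 / real n * (((1 + \<alpha>) ^ (2 * n) - 1) / (\<alpha> * (\<alpha> + 2)))) ^ l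
             * (norm (x0 - xstar))\<^sup>2
       \<and> (LINT \<omega>|M. f (rpcd A (\<lambda>m. \<pi> m \<omega>) x0 (l * n))) - f xstar
           \<le> (1 - \<mu> / real n * (((1 + \<alpha>) ^ (2 * n) - 1) / (\<alpha> * (\<alpha> + 2)))) ^ l
             * (f x0 - f xstar)"
proof -
  let ?b = "1 + \<alpha>"
  have \<mu>_pos: "0 < \<mu>"
    using n(2) \<alpha>(2) pos_less_divide_eq[of "real n - 1" \<alpha> 1] by (simp add: \<mu>)
  define \<rho> where "\<rho> = (\<Sum>j<n. (1 - ?b ^ j * \<mu>)\<^sup>2) / n"
  define \<sigma> where "\<sigma> = 1 - \<mu> / n * (\<Sum>j<n. ?b ^ (2 * j))"
  have \<rho>_eq: "\<rho> = 1 - 2 * \<mu> / real n * ((?b ^ n - 1) / \<alpha>)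
      + \<mu>\<^sup>2 / real n * ((?b ^ (2 * n) - 1) / (\<alpha> * (\<alpha> + 2)))"
    unfolding \<rho>_def sum_squares_mean_factor[OF \<alpha>(1)]
    using n(2) by (simp add: add_divide_distrib diff_divide_distrib)
  have \<sigma>_eq: "\<sigma> = 1 - \<mu> / real n * ((?b ^ (2 * n) - 1) / (\<alpha> * (\<alpha> + 2)))"
    unfolding \<sigma>_def sum_square_powers[OF \<alpha>(1)] ..
  have quad_nonneg: "0 \<le> quad (hess \<alpha>) x" for x :: "real^'n"
  proof -
    have "0 \<le> \<mu> * (norm x)\<^sup>2"
      using \<mu>_pos by simp
    also have "\<dots> \<le> x \<bullet> (hess \<alpha> *v x)"
      using hess_lower[of \<alpha> x] \<alpha>(1) by (simp add: \<mu> n(1))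
    finally show ?thesis
      by (simp add: quad_def)
  qed
  have \<rho>_nonneg: "0 \<le> \<rho>"
    by (simp add: \<rho>_def sum_nonneg)
  have \<sigma>_nonneg: "0 \<le> \<sigma>"
  proof -
    \<comment> \<open>The averaged objective is nonnegative and at most \<open>\<sigma>\<close> times its initial value, which is
       positive for the all-ones vector.\<close>
    let ?e = "1 :: real^'n"
    have "(norm ?e)\<^sup>2 = n"
      by (simp add: norm_squared_eq_sum n(1))
    then have "quad (hess \<alpha>) ?e = ((1 + \<alpha>) * n - \<alpha> * (real n)\<^sup>2) / 2"
      by (simp add: quad_def quad_hess n(1))
    also have "\<dots> = \<mu> * n / 2"
      by (simp add: \<mu> power2_eq_square algebra_simps)
    finally have quad_e: "quad (hess \<alpha>) ?e = \<mu> * n / 2" .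
    have pos: "0 < quad (hess \<alpha>) ?e"
      unfolding quad_e using \<mu>_pos n(2) by simp
    have "0 \<le> (\<Sum>ys\<in>permutations_of_set UNIV. quad (hess \<alpha>) (fold (cd_step (hess \<alpha>)) ys ?e))"
      by (intro sum_nonneg quad_nonneg)
    also have "\<dots> \<le> fact n * (\<sigma> * quad (hess \<alpha>) ?e)"
      unfolding \<sigma>_def by (rule sum_sweep_quad_le[OF \<alpha>(1) n \<mu>])
    finally have "0 \<le> fact n * quad (hess \<alpha>) ?e * \<sigma>"
      by (simp only: mult_ac)
    moreover have "0 < fact n * quad (hess \<alpha>) ?e"
      using pos by simp
    ultimately show ?thesis
      using zero_le_mult_iff not_less by blast
  qed
  have "(LINT \<omega>|M. (norm (rpcd A (\<lambda>m. \<pi> m \<omega>) x0 (l * n)))\<^sup>2) \<le> \<rho> ^ l * (norm x0)\<^sup>2"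
    unfolding n(1)
  proof (rule expectation_rpcd_le[OF \<pi> \<rho>_nonneg])
    fix x
    show "(\<Sum>ys\<in>permutations_of_set UNIV. (norm (fold (cd_step A) ys x))\<^sup>2)
        \<le> fact CARD('n) * (\<rho> * (norm x)\<^sup>2)"
      using sum_sweep_norm_le[OF \<alpha>(1) n \<mu>, of x] by (simp only: A \<rho>_def n(1))
  qed
  moreover have "(LINT \<omega>|M. f (rpcd A (\<lambda>m. \<pi> m \<omega>) x0 (l * n))) \<le> \<sigma> ^ l * f x0"
    unfolding n(1)
  proof (rule expectation_rpcd_le[OF \<pi> \<sigma>_nonneg])
    fix x
    show "(\<Sum>ys\<in>permutations_of_set UNIV. f (fold (cd_step A) ys x)) \<le> fact CARD('n) * (\<sigma> * f x)"
      using sum_sweep_quad_le[OF \<alpha>(1) n \<mu>, of x] by (simp only: f A \<sigma>_def n(1))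
  qed
  moreover have "f xstar = 0"
    by (simp add: f xstar quad_def)
  ultimately show ?thesis
    unfolding \<rho>_eq[symmetric] \<sigma>_eq[symmetric] by (simp add: xstar)
qed

end
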